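(* (Dixon's Identity) Let $m,n,k$ be even integers with $0\le k\le\min(m,n)$. Then $$c_{m,n,k}\left(\tfrac m2,\tfrac n2\right)=\sum_{l=0}^{k}(-1)^l\binom{\frac{m+n-2k}{2}}{\frac m2-l}\binom{\frac m2}{k-l}\binom{\frac n2}{l}=(-1)^{k/2}\,\frac{\left(\frac{m+n-k}{2}\right)!}{\left(\frac{m-k}{2}\right)!\left(\frac{n-k}{2}\right)!\left(\frac k2\right)!}.$$
   Context: For integers $m,n,k,i,j$ with $0\le k\le\min(m,n)$, $0\le i\le m$, $0\le j\le n$, $0\le i+j-k\le m+n-2k$, define $$c_{m,n,k}(i,j)=\sum_{l=0}^{k}(-1)^l\binom{i+j-k}{i-l}\binom{m-l}{k-l}\binom{n-k+l}{l},$$ where $\binom{a}{b}=0$ if $b<0$ or $b>a$. *)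

theory Defs
  imports Complex_Main
begin

text \<open>
  Binomial coefficient with integer arguments. It vanishes when the lower entry is negative or
  exceeds the upper one. This guard matters below: there the lower entry \<open>i - l\<close> can be
  negative, and \<^typ>\<open>nat\<close> subtraction would truncate it to 0 and give the value 1.
\<close>
definition ibinom :: "int \<Rightarrow> int \<Rightarrow> int" where
  "ibinom a b = (if 0 \<le> b \<and> b \<le> a then int (nat a choose nat b) else 0)"

text \<open>
  Only meant for \<open>0 \<le> k \<le> min m n\<close>, \<open>0 \<le> i \<le> m\<close>, \<open>0 \<le> j \<le> n\<close> and
  \<open>0 \<le> i + j - k \<le> m + n - 2 * k\<close>.
\<close>
definition c_coeff :: "int \<Rightarrow> int \<Rightarrow> int \<Rightarrow> int \<Rightarrow> int \<Rightarrow> int" where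
  "c_coeff m n k i j =
     (\<Sum>l\<in>{0..k}. (-1) ^ nat l *
        ibinom (i + j - k) (i - l) * ibinom (m - l) (k - l) * ibinom (n - k + l) l)"

end

theory Submission
  imports Defs
begin

text \<open>
  The first equality holds for arbitrary \<open>i\<close>, \<open>j\<close>: put \<open>N = i + j - k\<close>, \<open>A = m - i\<close>,
  \<open>B = n - j\<close>. By Pascal's rule both sums satisfy the same recurrences in \<open>A\<close> and in \<open>B\<close>; at
  \<open>A = B = 0\<close> the product of the three binomials is a multinomial coefficient, proportional to
  \<open>k choose l\<close>, so that the alternating sum vanishes unless \<open>k = 0\<close>.

  With \<open>x = k/2\<close>, \<open>y = (m - k)/2\<close>, \<open>z = (n - k)/2\<close> and \<open>l = x + t\<close> the second sum becomes, up to
  a factor, the sum over \<open>t\<close> of \<open>(-1)^t / ((x+t)! (x-t)! (y+t)! (y-t)! (z+t)! (z-t)!)\<close>. This is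
  evaluated by induction on \<open>z\<close> with a Wilf--Zeilberger pair.
\<close>

section \<open>Integer binomials and reciprocal factorials\<close>

lemma ibinom_Suc:
  "0 \<le> a \<Longrightarrow> ibinom (a + 1) b = ibinom a b + ibinom a (b - 1)"
proof -
  assume a: "0 \<le> a"
  consider "b < 0" | "b = 0" | "0 < b" by linarith
  then show ?thesis
  proof cases
    case 3
    have "nat (a + 1) choose nat b = (nat a choose nat b) + (nat a choose nat (b - 1))"
    proof -
      have "nat (a + 1) = Suc (nat a)" "nat b = Suc (nat (b - 1))" using a 3 by auto
      then show ?thesis by simp
    qed
    with a 3 show ?thesis by (auto simp: ibinom_def)
  qed (use a in \<open>auto simp: ibinom_def\<close>)
qed

text \<open>This is 1/Gamma(k+1) at the integers. The value 0 at negative \<open>k\<close> makes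
  out-of-range terms vanish and lets the recurrences below hold without side conditions.\<close>

definition inv_fact :: "int \<Rightarrow> rat" where
  "inv_fact k = (if k < 0 then 0 else 1 / fact (nat k))"

lemma inv_fact_neg [simp]: "k < 0 \<Longrightarrow> inv_fact k = 0"
  by (simp add: inv_fact_def)

lemma inv_fact_of_nat [simp]: "inv_fact (int n) = 1 / fact n"
  by (simp add: inv_fact_def)

lemma inv_fact_diff_1: "inv_fact (k - 1) = of_int k * inv_fact k"
proof (cases "0 < k")
  case True
  then obtain n where n: "k = int (Suc n)" by (metis zero_less_imp_eq_int gr0_implies_Suc)
  then have "inv_fact (k - 1) = 1 / fact n" by simp
  moreover have "inv_fact k = 1 / (of_nat (Suc n) * fact n)"
    unfolding n inv_fact_of_nat fact_Suc ..
  ultimately show ?thesis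
    unfolding n by (simp del: of_nat_Suc)
\<comment> \<open>At \<open>k = 0\<close> both sides vanish: the left by the default value, the
  right by the factor \<open>k\<close>.\<close>
qed (auto simp: inv_fact_def)

lemma of_int_ibinom:
  assumes "0 \<le> a"
  shows "rat_of_int (ibinom a b) = fact (nat a) * inv_fact b * inv_fact (a - b)"
proof (cases "0 \<le> b \<and> b \<le> a")
  case True
  then have "nat (a - b) = nat a - nat b" "nat b \<le> nat a" by auto
  then show ?thesis using True
    by (simp add: ibinom_def inv_fact_def binomial_fact)
qed (auto simp: ibinom_def inv_fact_def)

text \<open>Up to the factor \<open>1 / k!\<close> this is the alternating sum of row
  \<open>k\<close> of Pascal's triangle.\<close>

lemma alternating_sum_inv_fact:
  assumes "0 < k"
  shows "(\<Sum>l\<in>{0..k}. (-1) ^ nat l * (inv_fact (k - l) * inv_fact l)) = 0"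
proof -
  obtain n where n: "k = int n" "0 < n" using assms by (metis zero_less_imp_eq_int)
  have "(\<Sum>l\<in>{0..k}. (-1) ^ nat l * (inv_fact (k - l) * inv_fact l))
      = (\<Sum>l\<le>n. (-1) ^ l * (inv_fact (int n - int l) * inv_fact (int l)))"
    by (rule sum.reindex_bij_witness[of _ int nat]) (auto simp: n)
  also have "\<dots> = (\<Sum>l\<le>n. (-1) ^ l * rat_of_nat (n choose l) / fact n)"
    by (intro sum.cong refl) (auto simp: inv_fact_def binomial_fact nat_diff_distrib)
  also have "\<dots> = 0"
    using choose_alternating_sum[OF n(2), where ?'a = rat] by (simp flip: sum_divide_distrib)
  finally show ?thesis .
qed

section \<open>The first equality, by Pascal recurrences\<close>

text \<open>Taking \<open>N\<close> as a parameter of its own, rather than \<open>i + j - k\<close>,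
  keeps it fixed while the recurrences lower \<open>k\<close> and \<open>i\<close>.\<close>

definition cg_sum :: "int \<Rightarrow> int \<Rightarrow> int \<Rightarrow> int \<Rightarrow> int \<Rightarrow> int" where
  "cg_sum N A B k i = (\<Sum>l\<in>{0..k}. (-1) ^ nat l * ibinom N (i - l) *
     ibinom (A + i - l) (k - l) * ibinom (B + N - i + l) l)"

definition cg_sum' :: "int \<Rightarrow> int \<Rightarrow> int \<Rightarrow> int \<Rightarrow> int \<Rightarrow> int" where
  "cg_sum' N A B k i = (\<Sum>l\<in>{0..k}. (-1) ^ nat l * ibinom N (i - l) *
     ibinom A (k - l) * ibinom B l)"

lemma sum_drop_last_int:
  fixes f :: "int \<Rightarrow> 'a::comm_monoid_add"
  assumes "0 \<le> k \<Longrightarrow> f k = 0"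
  shows "sum f {0..k - 1} = sum f {0..k}"
  by (rule sum.mono_neutral_left) (use assms in \<open>auto simp: not_le dest!: antisym\<close>)

lemma sum_shift_int:
  fixes f :: "int \<Rightarrow> 'a::comm_monoid_add"
  assumes "0 \<le> k \<Longrightarrow> f 0 = 0"
  shows "sum f {0..k} = (\<Sum>l\<in>{0..k - 1}. f (l + 1))"
proof -
  have "sum f {0..k} = sum f {1..k}"
  proof (rule sum.mono_neutral_right)
    show "\<forall>l\<in>{0..k} - {1..k}. f l = 0"
    proof
      fix l assume "l \<in> {0..k} - {1..k}"
      then have "l = 0" "0 \<le> k" by auto
      with assms show "f l = 0" by simp
    qed
  qed auto
  also have "\<dots> = (\<Sum>l\<in>{0..k - 1}. f (l + 1))"
    by (rule sum.reindex_bij_witness[of _ "\<lambda>l. l + 1" "\<lambda>l. l - 1"]) auto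
  finally show ?thesis .
qed

lemma ibinom_outside [simp]: "b < 0 \<Longrightarrow> ibinom a b = 0" "a < b \<Longrightarrow> ibinom a b = 0"
  by (auto simp: ibinom_def)

lemma cg_sum_Suc_A:
  assumes "0 \<le> A"
  shows "cg_sum N (A + 1) B k i = cg_sum N A B k i + cg_sum N A B (k - 1) i"
proof -
  have "cg_sum N A B (k - 1) i = (\<Sum>l\<in>{0..k}. (-1) ^ nat l * ibinom N (i - l) *
     ibinom (A + i - l) (k - 1 - l) * ibinom (B + N - i + l) l)"
    unfolding cg_sum_def by (rule sum_drop_last_int) simp
  moreover have "(-1) ^ nat l * ibinom N (i - l) * ibinom (A + 1 + i - l) (k - l) * c =
      (-1) ^ nat l * ibinom N (i - l) * ibinom (A + i - l) (k - l) * c +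
      (-1) ^ nat l * ibinom N (i - l) * ibinom (A + i - l) (k - 1 - l) * c" for l c
  \<comment> \<open>Pascal's rule needs a nonnegative upper entry \<open>A + i - l\<close>; when
    \<open>i - l < 0\<close> the factor \<open>ibinom N (i - l)\<close> already kills every
    term.\<close>
  proof (cases "i - l < 0")
    case False
    then show ?thesis
      using ibinom_Suc[of "A + i - l" "k - l"] assms by (simp add: algebra_simps)
  qed simp
  ultimately show ?thesis
    unfolding cg_sum_def by (simp add: sum.distrib)
qed

lemma cg_sum'_Suc_A:
  assumes "0 \<le> A"
  shows "cg_sum' N (A + 1) B k i = cg_sum' N A B k i + cg_sum' N A B (k - 1) i"
proof -
  have "cg_sum' N A B (k - 1) i = (\<Sum>l\<in>{0..k}. (-1) ^ nat l * ibinom N (i - l) *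
     ibinom A (k - 1 - l) * ibinom B l)"
    unfolding cg_sum'_def by (rule sum_drop_last_int) simp
  moreover have "ibinom (A + 1) (k - l) = ibinom A (k - l) + ibinom A (k - 1 - l)" for l
    using ibinom_Suc[of A "k - l"] assms by (simp add: algebra_simps)
  ultimately show ?thesis
    unfolding cg_sum'_def by (simp add: sum.distrib algebra_simps)
qed

text \<open>Pascal's rule on the last binomial leaves a sum with lower entry \<open>l - 1\<close>.
  Replacing \<open>l\<close> by \<open>l + 1\<close> restores the shape with \<open>k - 1\<close>
  and \<open>i - 1\<close>, and flips the sign.\<close>

lemma cg_sum_Suc_B:
  assumes "0 \<le> B"
  shows "cg_sum N A (B + 1) k i = cg_sum N A B k i - cg_sum N A B (k - 1) (i - 1)"
proof -
  have "(\<Sum>l\<in>{0..k}. (-1) ^ nat l * ibinom N (i - l) *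
     ibinom (A + i - l) (k - l) * ibinom (B + N - i + l) (l - 1)) = - cg_sum N A B (k - 1) (i - 1)"
    unfolding cg_sum_def
    by (subst sum_shift_int)
      (auto simp: nat_add_distrib algebra_simps simp flip: sum_negf intro!: sum.cong)
  moreover have "(-1) ^ nat l * ibinom N (i - l) * c * ibinom (B + 1 + N - i + l) l =
      (-1) ^ nat l * ibinom N (i - l) * c * ibinom (B + N - i + l) l +
      (-1) ^ nat l * ibinom N (i - l) * c * ibinom (B + N - i + l) (l - 1)" for l c
  proof (cases "N < i - l")
    case False
    then show ?thesis
      using ibinom_Suc[of "B + N - i + l" l] assms by (simp add: algebra_simps)
  qed simp
  ultimately show ?thesis
    unfolding cg_sum_def by (simp add: sum.distrib)
qed

lemma cg_sum'_Suc_B: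
  assumes "0 \<le> B"
  shows "cg_sum' N A (B + 1) k i = cg_sum' N A B k i - cg_sum' N A B (k - 1) (i - 1)"
proof -
  have "(\<Sum>l\<in>{0..k}. (-1) ^ nat l * ibinom N (i - l) * ibinom A (k - l) * ibinom B (l - 1))
      = - cg_sum' N A B (k - 1) (i - 1)"
    unfolding cg_sum'_def
    by (subst sum_shift_int)
      (auto simp: nat_add_distrib algebra_simps simp flip: sum_negf intro!: sum.cong)
  with assms show ?thesis
    unfolding cg_sum'_def by (simp add: ibinom_Suc sum.distrib algebra_simps)
qed

lemma cg_sum_0_0:
  assumes "0 \<le> N"
  shows "cg_sum N 0 0 k i = (if k = 0 then ibinom N i else 0)"
proof (cases "0 < k")
  case True
  have summand: "rat_of_int ((-1) ^ nat l * ibinom N (i - l) * ibinom (i - l) (k - l)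
        * ibinom (N - i + l) l)
      = fact (nat N) * inv_fact (i - k) * inv_fact (N - i)
        * ((-1) ^ nat l * (inv_fact (k - l) * inv_fact l))" for l
  \<comment> \<open>Within this range the factorials of \<open>i - l\<close> and
    \<open>N - i + l\<close> cancel between the three binomials.\<close>
  proof (cases "0 \<le> i - l \<and> i - l \<le> N")
    case bounds: True
    then have *: "inv_fact (i - l) = 1 / fact (nat (i - l))"
      "inv_fact (N + l - i) = 1 / fact (nat (N + l - i))"
      by (auto simp: inv_fact_def algebra_simps)
    show ?thesis
      using assms bounds by (simp add: of_int_ibinom * algebra_simps)
  next
    case False
    \<comment> \<open>The arguments add up to \<open>i - l\<close> and to \<open>N - i + l\<close>
      respectively. One of these sums is negative, hence so is one of its summands.\<close>
    then have "inv_fact (i - k) * inv_fact (k - l) = 0 \<or> inv_fact (N - i) * inv_fact l = 0"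
      by (auto simp: inv_fact_def)
    with False show ?thesis by auto
  qed
  have "rat_of_int (cg_sum N 0 0 k i) = 0"
    unfolding cg_sum_def of_int_sum add_0 summand
    by (simp add: alternating_sum_inv_fact[OF True] flip: sum_distrib_left)
  with True show ?thesis by simp
next
  case False
  then show ?thesis
    by (cases "k = 0") (auto simp: cg_sum_def ibinom_def)
qed

lemma cg_sum'_0_0: "cg_sum' N 0 0 k i = (if k = 0 then ibinom N i else 0)"
proof (cases "0 < k")
  case True
  then have "ibinom 0 (k - l) * ibinom 0 l = 0" for l
    by (auto simp: ibinom_def)
  then have "cg_sum' N 0 0 k i = 0"
    unfolding cg_sum'_def by (intro sum.neutral) auto
  with True show ?thesis by simp
next
  case False
  then show ?thesis
    by (cases "k = 0") (auto simp: cg_sum'_def ibinom_def)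
qed

text \<open>Induction on \<open>B\<close>, with induction on \<open>A\<close> inside the base case.
  The step in \<open>B\<close> changes \<open>k\<close> and \<open>i\<close>, the step in
  \<open>A\<close> only \<open>k\<close>; \<open>k\<close> may become negative, where both sums are
  empty.\<close>

lemma cg_sum_eq_cg_sum':
  assumes "0 \<le> N"
  shows "cg_sum N (int A) (int B) k i = cg_sum' N (int A) (int B) k i"
proof (induction B arbitrary: k i)
  case 0
  show ?case
  proof (induction A arbitrary: k)
    case 0
    show ?case using assms by (simp add: cg_sum_0_0 cg_sum'_0_0)
  next
    case (Suc A)
    then show ?case
      using cg_sum_Suc_A[of "int A"] cg_sum'_Suc_A[of "int A"] by (simp add: add.commute)
  qed
next
  case (Suc B)
  then show ?case
    using cg_sum_Suc_B[of "int B"] cg_sum'_Suc_B[of "int B"] by (simp add: add.commute)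
qed

text \<open>The hypotheses make \<open>m - i\<close>, \<open>n - j\<close> and
  \<open>i + j - k\<close> nonnegative, as the induction on \<open>A\<close> and \<open>B\<close>
  demands.\<close>

lemma c_coeff_eq:
  assumes "i \<le> m" "j \<le> n" "k \<le> i + j"
  shows "c_coeff m n k i j = (\<Sum>l\<in>{0..k}. (-1) ^ nat l *
           ibinom (i + j - k) (i - l) * ibinom (m - i) (k - l) * ibinom (n - j) l)"
proof -
  have "c_coeff m n k i j = cg_sum (i + j - k) (m - i) (n - j) k i"
    by (simp add: c_coeff_def cg_sum_def algebra_simps)
  also have "\<dots> = cg_sum' (i + j - k) (m - i) (n - j) k i"
    using cg_sum_eq_cg_sum'[of "i + j - k" "nat (m - i)" "nat (n - j)"] assms by simp
  finally show ?thesis by (simp add: cg_sum'_def)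
qed

section \<open>Dixon's sum, by a Wilf-Zeilberger pair\<close>

definition dixon_term :: "int \<Rightarrow> int \<Rightarrow> int \<Rightarrow> int \<Rightarrow> rat" where
  "dixon_term x y z t = (-1) powi t * (inv_fact (x + t) * inv_fact (x - t)) *
     (inv_fact (y + t) * inv_fact (y - t)) * (inv_fact (z + t) * inv_fact (z - t))"

text \<open>The certificate: \<open>dixon_term x y (z + 1) t\<close> times
  \<open>- (x + t) * (y + t) * (z + 1 + t) / 2\<close>, with these factors absorbed into
  \<open>inv_fact\<close>.\<close>

definition dixon_cert :: "int \<Rightarrow> int \<Rightarrow> int \<Rightarrow> int \<Rightarrow> rat" where
  "dixon_cert x y z t = - 1 / 2 * (-1) powi t * (inv_fact (x + t - 1) * inv_fact (x - t)) *
     (inv_fact (y + t - 1) * inv_fact (y - t)) * (inv_fact (z + t) * inv_fact (z + 1 - t))"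

text \<open>Every term is a polynomial multiple of \<open>P\<close>, and both sides come to
  \<open>(x * y * (z + 1) + t^2 * (x + y + z + 1)) * P\<close>.\<close>

lemma dixon_cert:
  "of_int ((x + z + 1) * (y + z + 1) * (z + 1)) * dixon_term x y (z + 1) t
     - of_int (x + y + z + 1) * dixon_term x y z t
   = dixon_cert x y z (t + 1) - dixon_cert x y z t"
proof -
  define P where "P = dixon_term x y (z + 1) t"
  have shift: "inv_fact (x + t - 1) = of_int (x + t) * inv_fact (x + t)"
    "inv_fact (y + t - 1) = of_int (y + t) * inv_fact (y + t)"
    "inv_fact (z + t) = of_int (z + 1 + t) * inv_fact (z + 1 + t)"
    "inv_fact (x - (t + 1)) = of_int (x - t) * inv_fact (x - t)"
    "inv_fact (y - (t + 1)) = of_int (y - t) * inv_fact (y - t)"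
    "inv_fact (z - t) = of_int (z + 1 - t) * inv_fact (z + 1 - t)"
    unfolding inv_fact_diff_1[symmetric] by (simp_all add: algebra_simps)
  have 1: "dixon_term x y z t = of_int ((z + 1 + t) * (z + 1 - t)) * P"
    unfolding P_def dixon_term_def shift by simp
  have 2: "dixon_cert x y z t = - 1 / 2 * of_int ((x + t) * (y + t) * (z + 1 + t)) * P"
    unfolding P_def dixon_term_def dixon_cert_def shift by simp
  have args: "x + (t + 1) - 1 = x + t" "y + (t + 1) - 1 = y + t"
    "z + (t + 1) = z + 1 + t" "z + 1 - (t + 1) = z - t"
    by simp_all
  have sign: "(-1) powi (t + 1) = - ((-1) powi t :: rat)"
    by (simp add: power_int_add)
  have 3: "dixon_cert x y z (t + 1) = 1 / 2 * of_int ((x - t) * (y - t) * (z + 1 - t)) * P"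
    unfolding P_def dixon_term_def dixon_cert_def args shift sign by simp
  show ?thesis
    unfolding 1 2 3 P_def[symmetric] by (simp add: field_simps)
qed

lemma sum_dixon_term:
  "(\<Sum>t\<in>{- int x..int x}. dixon_term (int x) (int y) (int z) t) =
     fact (x + y + z) / (fact (x + y) * fact (y + z) * fact (z + x) * fact x * fact y * fact z)"
proof (induction z)
  case 0
  have "(\<Sum>t\<in>{- int x..int x}. dixon_term (int x) (int y) 0 t)
      = (\<Sum>t\<in>{0}. dixon_term (int x) (int y) 0 t)"
  proof (rule sum.mono_neutral_right)
    show "\<forall>t\<in>{- int x..int x} - {0}. dixon_term (int x) (int y) 0 t = 0"
      by (auto simp: dixon_term_def inv_fact_def)
  qed auto
  then show ?case by (simp add: dixon_term_def inv_fact_def field_simps)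
next
  case (Suc z)
  let ?I = "{- int x..int x}"
  let ?S = "\<lambda>z. \<Sum>t\<in>?I. dixon_term (int x) (int y) z t"
  let ?G = "dixon_cert (int x) (int y) (int z)"
  \<comment> \<open>The certificate telescopes to 0: it vanishes at \<open>t = - x\<close> through
    \<open>inv_fact (x + t - 1)\<close> and at \<open>t = x + 1\<close> through
    \<open>inv_fact (x - t)\<close>.\<close>
  have "(\<Sum>t\<in>?I. ?G (t + 1)) = sum ?G {- int x + 1..int x + 1}"
    by (rule sum.reindex_bij_witness[of _ "\<lambda>t. t - 1" "\<lambda>t. t + 1"]) auto
  also have "\<dots> = sum ?G {- int x..int x + 1}"
    by (rule sum.mono_neutral_left)
      (auto simp: dixon_cert_def inv_fact_def)
  also have "\<dots> = sum ?G ?I"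
    by (rule sum.mono_neutral_right)
      (auto simp: dixon_cert_def inv_fact_def)
  finally have "(\<Sum>t\<in>?I. ?G (t + 1) - ?G t) = 0"
    by (simp add: sum_subtractf)
  then have rec: "of_int ((int x + int z + 1) * (int y + int z + 1) * (int z + 1)) * ?S (int z + 1)
      = of_int (int x + int y + int z + 1) * ?S (int z)"
    unfolding dixon_cert[symmetric] by (simp add: sum_subtractf flip: sum_distrib_left)
  define C :: rat where "C = of_nat ((x + z + 1) * (y + z + 1) * (z + 1))"
  have C: "C \<noteq> 0" unfolding C_def of_nat_eq_0_iff by simp
  have "C * ?S (int (Suc z)) = of_nat (x + y + z + 1) * ?S (int z)"
  proof -
    have "C = of_int ((int x + int z + 1) * (int y + int z + 1) * (int z + 1))"
      "of_nat (x + y + z + 1) = rat_of_int (int x + int y + int z + 1)"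
      "int (Suc z) = int z + 1"
      by (simp_all add: C_def algebra_simps)
    with rec show ?thesis by (simp only:)
  qed
  then have "?S (int (Suc z)) = of_nat (x + y + z + 1) * ?S (int z) / C"
    using C by (simp add: field_simps)
  also have "\<dots> = fact (x + y + Suc z) /
      (fact (x + y) * fact (y + Suc z) * fact (Suc z + x) * fact x * fact y * fact (Suc z))"
  proof -
    have "fact (y + Suc z) = of_nat (y + z + 1) * (fact (y + z) :: rat)"
      "fact (Suc z + x) = of_nat (x + z + 1) * (fact (z + x) :: rat)"
      "fact (x + y + Suc z) = of_nat (x + y + z + 1) * (fact (x + y + z) :: rat)"
      "fact (Suc z) = of_nat (z + 1) * (fact z :: rat)"
      by (simp_all add: add_ac)
    then show ?thesis
      unfolding Suc.IH C_def of_nat_mult by (simp only: times_divide_eq_left times_divide_eq_right divide_divide_eq_left mult_ac)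
  qed
  finally show ?case .
qed

text \<open>At \<open>l = x + t\<close> the lower entries are \<open>y - t\<close>,
  \<open>x - t\<close> and \<open>x + t\<close>, with complements \<open>z + t\<close>,
  \<open>y + t\<close> and \<open>z - t\<close>: the six factorials of \<open>dixon_term\<close>.
  The numerators form \<open>?c\<close>, which cancels against the closed form.\<close>

lemma sum_ibinom_dixon:
  fixes x y z :: nat
  shows "rat_of_int (\<Sum>l\<in>{0..2 * int x}. (-1) ^ nat l * ibinom (int (y + z)) (int (x + y) - l) *
           ibinom (int (x + y)) (2 * int x - l) * ibinom (int (x + z)) l) =
         (-1) ^ x * (fact (x + y + z) / (fact y * fact z * fact x))"
proof -
  let ?c = "fact (y + z) * fact (x + y) * fact (x + z) :: rat"
  have "rat_of_int (\<Sum>l\<in>{0..2 * int x}. (-1) ^ nat l * ibinom (int (y + z)) (int (x + y) - l) *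
           ibinom (int (x + y)) (2 * int x - l) * ibinom (int (x + z)) l)
      = (\<Sum>t\<in>{- int x..int x}. (-1) ^ x * ?c * dixon_term (int x) (int y) (int z) t)"
    unfolding of_int_sum
  proof (rule sum.reindex_bij_witness[of _ "\<lambda>t. t + int x" "\<lambda>l. l - int x"])
    fix l assume "l \<in> {0..2 * int x}"
    then have "rat_of_int ((-1) ^ nat l) = (-1) powi (int x + (l - int x))"
      by (auto simp: power_int_def)
    also have "\<dots> = (-1) ^ x * (-1) powi (l - int x)"
      by (subst power_int_add) auto
    finally show "(-1) ^ x * ?c * dixon_term (int x) (int y) (int z) (l - int x)
      = rat_of_int ((-1) ^ nat l * ibinom (int (y + z)) (int (x + y) - l) *
           ibinom (int (x + y)) (2 * int x - l) * ibinom (int (x + z)) l)"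
      by (simp add: of_int_ibinom dixon_term_def nat_add_distrib algebra_simps)
  qed auto
  also have "\<dots> = (-1) ^ x * ?c * (\<Sum>t\<in>{- int x..int x}. dixon_term (int x) (int y) (int z) t)"
    by (simp only: sum_distrib_left)
  also have "\<dots> = (-1) ^ x * (fact (x + y + z) / (fact y * fact z * fact x))"
    unfolding sum_dixon_term by (simp add: field_simps add.commute)
  finally show ?thesis .
qed

theorem theorem3:
  fixes m n k :: int
  assumes "even m" and "even n" and "even k"
    and "0 \<le> k" and "k \<le> min m n"
  shows "c_coeff m n k (m div 2) (n div 2) =
           (\<Sum>l\<in>{0..k}. (-1) ^ nat l *
              ibinom ((m + n - 2 * k) div 2) (m div 2 - l) *
              ibinom (m div 2) (k - l) * ibinom (n div 2) l)
       \<and> rat_of_int (c_coeff m n k (m div 2) (n div 2)) =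
           (-1) ^ nat (k div 2) *
             (fact (nat ((m + n - k) div 2)) /
               (fact (nat ((m - k) div 2)) * fact (nat ((n - k) div 2)) * fact (nat (k div 2))))"
proof -
  obtain a b c where abc: "m = 2 * a" "n = 2 * b" "k = 2 * c"
    using assms(1-3) by (auto elim!: evenE)
  \<comment> \<open>Since \<open>0 <= k <= min m n\<close>, the numbers \<open>c\<close>,
    \<open>a - c\<close> and \<open>b - c\<close> are nonnegative, so \<open>nat\<close> truncates
    nothing.\<close>
  define x y z where "x = nat c" and "y = nat (a - c)" and "z = nat (b - c)"
  have xyz: "m = 2 * int (x + y)" "n = 2 * int (x + z)" "k = 2 * int x"
    using assms(4,5) by (auto simp: abc x_def y_def z_def)
  have halves: "m div 2 = int (x + y)" "n div 2 = int (x + z)" "k div 2 = int x"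
    "(m + n - 2 * k) div 2 = int (y + z)" "(m + n - k) div 2 = int (x + y + z)"
    "(m - k) div 2 = int y" "(n - k) div 2 = int z"
    unfolding xyz by auto
  have "c_coeff m n k (m div 2) (n div 2) =
      (\<Sum>l\<in>{0..k}. (-1) ^ nat l * ibinom (int (y + z)) (int (x + y) - l) *
              ibinom (int (x + y)) (k - l) * ibinom (int (x + z)) l)"
    unfolding halves by (subst c_coeff_eq) (auto simp: xyz algebra_simps)
  then show ?thesis
    using sum_ibinom_dixon[where x = x and y = y and z = z] unfolding halves nat_int by (simp only: xyz(3))
qed

end
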